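(* Let $n\ge 1$ and $k\ge 0$ be integers. Then $$p^{1}_{n,n+k;\le n+k}=p^{2}_{n,n+k;\le n+k}=\cdots=p^{k+1}_{n,n+k;\le n+k}.$$
   Context: Parking model: there are $m$ parking spaces in a line, numbered $1,\dots,m$ from left to right. A preference set of length $n$ is a sequence $(a_1,\dots,a_n)$ of integers with $1\le a_i\le m$. Cars $1,\dots,n$ arrive in this order; car $i$ goes to space $a_i$ and parks in the first unoccupied space numbered $\ge a_i$ if such a space exists, and otherwise fails to park. A preference set is a $k$-flaw preference set if exactly $k$ cars fail to park; a $0$-flaw preference set is a parking function. $\mathcal{P}_{n,m;\le s;k}$ denotes the set of $k$-flaw preference sets $(a_1,\dots,a_n)$ of length $n$ with $m$ spaces such that $1\le a_i\le s$ for all $i$, and $\mathcal{P}^l_{n,m;\le s;k}$ its subset with $a_1=l$; $p_{n,m;\le s;k}$ and $p^l_{n,m;\le s;k}$ are their cardinalities. If the index $k$ is omitted, $k=0$. So $p^l_{n,n+k;\le n+k}$ is the number of parking functions $(a_1,\dots,a_n)$ with $n+k$ spaces, all $a_i\le n+k$, and $a_1=l$. *)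

theory Defs
  imports Main
begin

definition free_from :: "nat \<Rightarrow> nat set \<Rightarrow> nat \<Rightarrow> nat set" where
  "free_from m occ a = {j. a \<le> j \<and> j \<le> m \<and> j \<notin> occ}"

text \<open>\<open>flaws m occ as\<close> is the number of cars that fail to park when cars with preferences \<open>as\<close>
  arrive in this order on spaces \<open>1, \<dots>, m\<close> of which those in \<open>occ\<close> are already taken.\<close>

fun flaws :: "nat \<Rightarrow> nat set \<Rightarrow> nat list \<Rightarrow> nat" where
  "flaws m occ [] = 0"
| "flaws m occ (a # as) =
     (if free_from m occ a = {} then Suc (flaws m occ as)
      else flaws m (insert (Min (free_from m occ a)) occ) as)"

definition preference_set :: "nat \<Rightarrow> nat \<Rightarrow> nat list \<Rightarrow> bool" where
  "preference_set n m as \<longleftrightarrow> length as = n \<and> (\<forall>a\<in>set as. 1 \<le> a \<and> a \<le> m)"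

text \<open>The argument order is that of the indices in \<open>\<P>\<^bsub>n,m;\<le>s;k\<^esub>\<close>; parking functions are the
  case \<open>k = 0\<close>.\<close>

definition flaw_prefs :: "nat \<Rightarrow> nat \<Rightarrow> nat \<Rightarrow> nat \<Rightarrow> nat list set" where
  "flaw_prefs n m s k =
     {as. preference_set n m as \<and> (\<forall>a\<in>set as. 1 \<le> a \<and> a \<le> s) \<and> flaws m {} as = k}"

definition flaw_prefs_lead :: "nat \<Rightarrow> nat \<Rightarrow> nat \<Rightarrow> nat \<Rightarrow> nat \<Rightarrow> nat list set" where
  "flaw_prefs_lead l n m s k = {as \<in> flaw_prefs n m s k. as \<noteq> [] \<and> hd as = l}"

definition num_flaw_prefs_lead :: "nat \<Rightarrow> nat \<Rightarrow> nat \<Rightarrow> nat \<Rightarrow> nat \<Rightarrow> nat" where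
  "num_flaw_prefs_lead l n m s k = card (flaw_prefs_lead l n m s k)"

lemma finite_flaw_prefs: "finite (flaw_prefs n m s k)"
proof (rule finite_subset)
  show "flaw_prefs n m s k \<subseteq> {as. set as \<subseteq> {1..m} \<and> length as = n}"
    by (auto simp: flaw_prefs_def preference_set_def)
  show "finite {as. set as \<subseteq> {1..m} \<and> length as = n}"
    by (rule finite_lists_length_eq) simp
qed

end

theory Submission
  imports Defs
begin

text \<open>All cars park iff for every \<open>i\<close> at most as many cars prefer a space \<open>\<ge> i\<close> as there are
  free spaces \<open>\<ge> i\<close> (Hall's condition). With \<open>n\<close> cars and \<open>n + k\<close> spaces the condition holds
  trivially for \<open>i \<le> k + 1\<close>, while for \<open>i > k + 1\<close> it does not see a first preference
  \<open>l \<le> k + 1\<close>. Hence the possible continuations of a first preference \<open>l \<le> k + 1\<close> do not depend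
  on \<open>l\<close>.\<close>

lemma finite_free_from [simp]: "finite (free_from m occ a)"
  by (rule finite_subset[of _ "{..m}"]) (auto simp: free_from_def)

lemma card_free_from_insert:
  assumes "p \<in> free_from m occ a"
  shows "card (free_from m occ i) = card (free_from m (insert p occ) i) + (if i \<le> p then 1 else 0)"
proof (cases "i \<le> p")
  case True
  then have "free_from m occ i = insert p (free_from m (insert p occ) i)"
    and "p \<notin> free_from m (insert p occ) i"
    using assms by (auto simp: free_from_def)
  then show ?thesis
    using True by simp
next
  case False
  then have "free_from m (insert p occ) i = free_from m occ i"
    by (auto simp: free_from_def)
  then show ?thesis
    using False by simp
qed

text \<open>Induction over arrivals: once the car preferring \<open>a\<close> parks in
  \<open>p\<close>, supply drops by one for \<open>i \<le> p\<close> and demand for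
  \<open>i \<le> a\<close>, so the conditions before and after differ only for
  \<open>a < i \<le> p\<close>.\<close>

lemma flaws_eq_0_iff:
  "flaws m occ as = 0 \<longleftrightarrow> (\<forall>i. length (filter ((\<le>) i) as) \<le> card (free_from m occ i))"
proof (induction as arbitrary: occ)
  case Nil
  then show ?case by simp
next
  case (Cons a as)
  show ?case
  proof (cases "free_from m occ a = {}")
    case True
    \<comment> \<open>The first car alone violates the condition at \<open>a\<close>.\<close>
    then have "\<not> length (filter ((\<le>) a) (a # as)) \<le> card (free_from m occ a)"
      by simp
    with True show ?thesis
      by (metis flaws.simps(2) nat.distinct(1))
  next
    case False
    define p where "p = Min (free_from m occ a)"
    have p: "p \<in> free_from m occ a"
      unfolding p_def using False by (intro Min_in) auto
    have p_least: "p \<le> q" if "q \<in> free_from m occ a" for q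
      unfolding p_def using that by (intro Min_le) auto
    have "a \<le> p"
      using p by (simp add: free_from_def)
    note card_eq = card_free_from_insert[OF p]
    have step: "flaws m occ (a # as) = flaws m (insert p occ) as"
      using False by (simp add: p_def)
    show ?thesis
      unfolding step Cons.IH
    proof (intro iffI allI)
      fix i
      assume "\<forall>i. length (filter ((\<le>) i) as) \<le> card (free_from m (insert p occ) i)"
      then have "length (filter ((\<le>) i) as) \<le> card (free_from m (insert p occ) i)" by blast
      then show "length (filter ((\<le>) i) (a # as)) \<le> card (free_from m occ i)"
        using card_eq[of i] \<open>a \<le> p\<close> by (auto split: if_splits)
    next
      fix i
      assume hall: "\<forall>i. length (filter ((\<le>) i) (a # as)) \<le> card (free_from m occ i)"
      show "length (filter ((\<le>) i) as) \<le> card (free_from m (insert p occ) i)"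
      proof (cases "a < i \<and> i \<le> p")
        case True
        \<comment> \<open>There is no free space in \<open>[a, p)\<close>, so the condition at \<open>a\<close> gives the one at \<open>i\<close>.\<close>
        have "free_from m occ i = free_from m occ a"
          using True p_least by (force simp: free_from_def)
        moreover have "length (filter ((\<le>) i) as) \<le> length (filter ((\<le>) a) as)"
          using True by (induction as) auto
        moreover have "Suc (length (filter ((\<le>) a) as)) \<le> card (free_from m occ a)"
          using hall[rule_format, of a] by simp
        ultimately show ?thesis
          using card_eq[of i] True by simp
      next
        case False
        then show ?thesis
          using card_eq[of i] hall[rule_format, of i] \<open>a \<le> p\<close> by (auto split: if_splits)
      qed
    qed
  qed
qed

text \<open>For \<open>i > l'\<close> the new head is not counted; for \<open>i \<le> l'\<close> the
  spaces from \<open>i\<close> on suffice for all cars together.\<close>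

lemma flaws_Cons_eq_0_change_head:
  assumes "flaws m {} (l # as) = 0" and "l' + length as \<le> m"
  shows "flaws m {} (l' # as) = 0"
  unfolding flaws_eq_0_iff
proof
  fix i
  show "length (filter ((\<le>) i) (l' # as)) \<le> card (free_from m {} i)"
  proof (cases "i \<le> l'")
    case True
    have "free_from m {} i = {i..m}"
      by (auto simp: free_from_def)
    \<comment> \<open>Since \<open>{i..m}\<close> has \<open>m + 1 - i\<close> elements, this leaves
      one space for the head.\<close>
    moreover have "length (filter ((\<le>) i) as) + i \<le> m"
      using length_filter_le[of "(\<le>) i" as] True assms(2) by linarith
    ultimately show ?thesis
      using True by simp
  next
    case False
    have "length (filter ((\<le>) i) (l # as)) \<le> card (free_from m {} i)"
      using assms(1) unfolding flaws_eq_0_iff by blast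
    with False show ?thesis
      by (simp split: if_splits)
  qed
qed

text \<open>The head \<open>1\<close> serves as a fixed reference, so the set of tails does not
  mention \<open>l\<close>; injectivity of \<open>(#) l\<close> then gives equal
  cardinalities.\<close>

lemma flaw_prefs_lead_eq_image:
  assumes "n \<ge> 1" and "l \<in> {1..k+1}"
  shows "flaw_prefs_lead l n (n + k) (n + k) 0 =
    (#) l ` {as. length as = n - 1 \<and> set as \<subseteq> {1..n+k} \<and> flaws (n + k) {} (1 # as) = 0}"
    (is "_ = (#) l ` ?T")
proof -
  \<comment> \<open>Here \<open>l \<le> k + 1\<close> enters, as
    \<open>l + (n - 1) \<le> n + k\<close>.\<close>
  have swap: "flaws (n + k) {} (l # as) = 0 \<longleftrightarrow> flaws (n + k) {} (1 # as) = 0"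
    if "length as = n - 1" for as
    using flaws_Cons_eq_0_change_head[of "n + k" l as 1]
      flaws_Cons_eq_0_change_head[of "n + k" 1 as l] that assms by fastforce
  show ?thesis
  proof (intro set_eqI iffI)
    fix as
    assume "as \<in> flaw_prefs_lead l n (n + k) (n + k) 0"
    then obtain bs where as: "as = l # bs" and bs: "length bs = n - 1" "set bs \<subseteq> {1..n+k}"
      and "flaws (n + k) {} (l # bs) = 0"
      by (cases as) (auto simp: flaw_prefs_lead_def flaw_prefs_def preference_set_def subset_eq
          simp del: flaws.simps)
    then have "bs \<in> ?T"
      using swap by blast
    then show "as \<in> (#) l ` ?T"
      unfolding as by (rule imageI)
  next
    fix as
    assume "as \<in> (#) l ` ?T"
    then obtain bs where as: "as = l # bs" and bs: "length bs = n - 1" "set bs \<subseteq> {1..n+k}"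
      and "flaws (n + k) {} (1 # bs) = 0"
      by blast
    then have "flaws (n + k) {} (l # bs) = 0"
      using swap by blast
    then show "as \<in> flaw_prefs_lead l n (n + k) (n + k) 0"
      using as bs assms
      by (auto simp: flaw_prefs_lead_def flaw_prefs_def preference_set_def simp del: flaws.simps)
  qed
qed

theorem theorem4p1:
  fixes n k :: nat
  assumes "n \<ge> 1"
  shows "\<forall>i\<in>{1..k+1}. \<forall>j\<in>{1..k+1}.
           num_flaw_prefs_lead i n (n + k) (n + k) 0 = num_flaw_prefs_lead j n (n + k) (n + k) 0"
  by (simp add: num_flaw_prefs_lead_def flaw_prefs_lead_eq_image[OF assms] card_image
      del: flaws.simps)

end
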